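(* Let $Q$ be a nonzero commutative unital ring, let $n\ge 1$ and let $\mathbf w=(w_1,\ldots,w_n)$ be a vector of positive integers that is weakly equivalent to a vector of pairwise coprime (positive) integers. Let $P_{\mathbf w}=Q[x_1,\ldots,x_n]$ be the polynomial ring graded by $\deg x_i=w_i$, and let $d_{\mathbf w}=\operatorname{lcm}(w_1,\ldots,w_n)$. Then the Veronese subring $P_{\mathbf w}^{(d_{\mathbf w})}$ is generated in degree $1$.
   Context: For a $\mathbb Z_{\ge0}$-graded ring $S$ and an integer $r\ge1$, the $r$th Veronese subring is $S^{(r)}:=\bigoplus_{m\ge0}S_{rm}$, where $S_{rm}$ is the $m$th graded component of $S^{(r)}$. A graded ring $S$ is generated in degree $1$ if $S=S_0\oplus\bigoplus_{m\ge1}S_1^m$, where $S_1^m$ is the additive subgroup generated by $m$-fold products of elements of $S_1$. Consider the following operations on a nonempty vector $\mathbf w$ of positive integers: (1) permuting the entries; (2) adding or removing repeated entries; (3) multiplying all entries by the same positive integer or dividing all entries by a positive common divisor; (4) adding or removing entries equal to the least common multiple of the entries while not changing the least common multiple; (5) if the length of $\mathbf w$ is at least two and $\gcd(\mathbf w)=1$, choosing an index $i$ and either multiplying each entry $w_j$ with $j\ne i$ by the same positive integer coprime to $w_i$, or dividing each entry $w_j$ with $j\neq i$ by a positive common divisor of the entries $w_j$ with $j\ne i$. Two nonempty vectors of positive integers are weakly equivalent if they become equal after applying a suitable choice of any number of the operations (1)–(5). *)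

theory Defs
  imports "HOL-Library.Poly_Mapping" "HOL-Library.Multiset" "HOL.Hull"
begin

section \<open>Graded rings\<close>

text \<open>
  Rings are subsets of an ambient ring type; a grading of \<open>R\<close> is a family of subsets of \<open>R\<close>
  indexed by the natural numbers.
\<close>

definition additive_subgroup :: "'b::ab_group_add set \<Rightarrow> bool" where
  "additive_subgroup H \<longleftrightarrow> 0 \<in> H \<and> (\<forall>x\<in>H. \<forall>y\<in>H. x - y \<in> H)"

definition external_direct_sum :: "(nat \<Rightarrow> 'b::ab_group_add set) \<Rightarrow> (nat \<Rightarrow> 'b) set" where
  "external_direct_sum M = {f. (\<forall>m. f m \<in> M m) \<and> finite {m. f m \<noteq> 0}}"

definition internal_direct_sum :: "'b::ab_group_add set \<Rightarrow> (nat \<Rightarrow> 'b set) \<Rightarrow> bool" where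
  "internal_direct_sum A M \<longleftrightarrow>
     (\<forall>m. additive_subgroup (M m)) \<and> bij_betw Sum_any (external_direct_sum M) A"

definition graded_ring :: "'b::ring_1 set \<Rightarrow> (nat \<Rightarrow> 'b set) \<Rightarrow> bool" where
  "graded_ring R S \<longleftrightarrow> internal_direct_sum R S \<and> 1 \<in> S 0 \<and>
     (\<forall>i j. \<forall>x\<in>S i. \<forall>y\<in>S j. x * y \<in> S (i + j))"

definition veronese_component :: "nat \<Rightarrow> (nat \<Rightarrow> 'b set) \<Rightarrow> nat \<Rightarrow> 'b set" where
  "veronese_component r S m = S (r * m)"

definition veronese_subring :: "nat \<Rightarrow> (nat \<Rightarrow> 'b::ring_1 set) \<Rightarrow> 'b set" where
  "veronese_subring r S = Sum_any ` external_direct_sum (veronese_component r S)"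

definition additive_power :: "'b::ring_1 set \<Rightarrow> nat \<Rightarrow> 'b set" where
  "additive_power X m =
     additive_subgroup hull {prod_list xs | xs. length xs = m \<and> set xs \<subseteq> X}"

definition generated_in_degree_1 :: "'b::ring_1 set \<Rightarrow> (nat \<Rightarrow> 'b set) \<Rightarrow> bool" where
  "generated_in_degree_1 R S \<longleftrightarrow>
     internal_direct_sum R (\<lambda>m. if m = 0 then S 0 else additive_power (S 1) m)"


section \<open>Weighted polynomial rings\<close>

text \<open>
  A polynomial is a finitely supported map from exponent vectors to coefficients. The
  indeterminates are numbered from \<open>0\<close>, so that the indeterminate \<open>i\<close> has degree \<open>w ! i\<close>.
\<close>

definition polynomial_ring :: "nat \<Rightarrow> ((nat \<Rightarrow>\<^sub>0 nat) \<Rightarrow>\<^sub>0 'a::comm_ring_1) set" where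
  "polynomial_ring n = {p. \<forall>t \<in> Poly_Mapping.keys p. Poly_Mapping.keys t \<subseteq> {..<n}}"

definition weighted_degree :: "nat list \<Rightarrow> (nat \<Rightarrow>\<^sub>0 nat) \<Rightarrow> nat" where
  "weighted_degree w t = (\<Sum>i<length w. w ! i * Poly_Mapping.lookup t i)"

definition weighted_component ::
    "nat list \<Rightarrow> nat \<Rightarrow> ((nat \<Rightarrow>\<^sub>0 nat) \<Rightarrow>\<^sub>0 'a::comm_ring_1) set" where
  "weighted_component w d =
     {p \<in> polynomial_ring (length w). \<forall>t \<in> Poly_Mapping.keys p. weighted_degree w t = d}"


section \<open>Weak equivalence of weight vectors\<close>

definition multiply_others :: "nat \<Rightarrow> nat \<Rightarrow> nat list \<Rightarrow> nat list" where
  "multiply_others i c w = map (\<lambda>j. if j = i then w ! j else c * w ! j) [0..<length w]"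

definition divide_others :: "nat \<Rightarrow> nat \<Rightarrow> nat list \<Rightarrow> nat list" where
  "divide_others i c w = map (\<lambda>j. if j = i then w ! j else w ! j div c) [0..<length w]"

text \<open>
  The side condition \<open>us @ vs \<noteq> []\<close> keeps vectors nonempty. It is needed since \<open>Lcm {} = 1\<close>.
\<close>

inductive weak_step :: "nat list \<Rightarrow> nat list \<Rightarrow> bool" where
  permute: "mset v = mset w \<Longrightarrow> weak_step w v"
| add_repeated: "x \<in> set (us @ vs) \<Longrightarrow> weak_step (us @ vs) (us @ x # vs)"
| remove_repeated: "x \<in> set (us @ vs) \<Longrightarrow> weak_step (us @ x # vs) (us @ vs)"
| multiply: "0 < c \<Longrightarrow> weak_step w (map (\<lambda>x. c * x) w)"
| divide: "0 < c \<Longrightarrow> \<forall>x\<in>set w. c dvd x \<Longrightarrow> weak_step w (map (\<lambda>x. x div c) w)"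
| add_lcm: "us @ vs \<noteq> [] \<Longrightarrow> x = Lcm (set (us @ vs)) \<Longrightarrow>
    Lcm (set (us @ x # vs)) = Lcm (set (us @ vs)) \<Longrightarrow> weak_step (us @ vs) (us @ x # vs)"
| remove_lcm: "us @ vs \<noteq> [] \<Longrightarrow> x = Lcm (set (us @ x # vs)) \<Longrightarrow>
    Lcm (set (us @ vs)) = Lcm (set (us @ x # vs)) \<Longrightarrow> weak_step (us @ x # vs) (us @ vs)"
| multiply_others: "2 \<le> length w \<Longrightarrow> Gcd (set w) = 1 \<Longrightarrow> i < length w \<Longrightarrow>
    0 < c \<Longrightarrow> coprime c (w ! i) \<Longrightarrow> weak_step w (multiply_others i c w)"
| divide_others: "2 \<le> length w \<Longrightarrow> Gcd (set w) = 1 \<Longrightarrow> i < length w \<Longrightarrow>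
    0 < c \<Longrightarrow> \<forall>j<length w. j \<noteq> i \<longrightarrow> c dvd w ! j \<Longrightarrow> weak_step w (divide_others i c w)"

definition weakly_equivalent :: "nat list \<Rightarrow> nat list \<Rightarrow> bool" where
  "weakly_equivalent v w \<longleftrightarrow> (\<exists>u. weak_step\<^sup>*\<^sup>* v u \<and> weak_step\<^sup>*\<^sup>* w u)"

definition weight_vector :: "nat list \<Rightarrow> bool" where
  "weight_vector w \<longleftrightarrow> w \<noteq> [] \<and> (\<forall>x\<in>set w. 0 < x)"

definition pairwise_coprime :: "nat list \<Rightarrow> bool" where
  "pairwise_coprime v \<longleftrightarrow>
     (\<forall>i<length v. \<forall>j<length v. i \<noteq> j \<longrightarrow> coprime (v ! i) (v ! j))"


section \<open>Consistency of the definitions\<close>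

lemma additive_subgroup_sum:
  assumes "additive_subgroup H" "\<And>i. i \<in> I \<Longrightarrow> f i \<in> H"
  shows "sum f I \<in> H"
proof -
  have add: "x + y \<in> H" if "x \<in> H" "y \<in> H" for x y
  proof -
    have "0 - y \<in> H" using assms(1) that unfolding additive_subgroup_def by blast
    then have "x - (0 - y) \<in> H" using assms(1) that unfolding additive_subgroup_def by blast
    then show ?thesis by simp
  qed
  show ?thesis
    using assms(2)
  proof (induction I rule: infinite_finite_induct)
    case (insert i I)
    then show ?case using add by simp
  qed (use assms(1) in \<open>auto simp: additive_subgroup_def\<close>)
qed

lemma weighted_degree_add:
  "weighted_degree w (s + t) = weighted_degree w s + weighted_degree w t"
  by (simp add: weighted_degree_def lookup_add algebra_simps sum.distrib)

lemma additive_subgroup_weighted_component: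
  "additive_subgroup (weighted_component w d :: ((nat \<Rightarrow>\<^sub>0 nat) \<Rightarrow>\<^sub>0 'a::comm_ring_1) set)"
proof -
  have "Poly_Mapping.keys (p - q) \<subseteq> Poly_Mapping.keys p \<union> Poly_Mapping.keys q"
    for p q :: "(nat \<Rightarrow>\<^sub>0 nat) \<Rightarrow>\<^sub>0 'a"
    by (auto simp: in_keys_iff lookup_minus)
  then show ?thesis
    unfolding additive_subgroup_def weighted_component_def polynomial_ring_def by fastforce
qed

lemma lookup_Sum_any:
  fixes f :: "nat \<Rightarrow> ('b \<Rightarrow>\<^sub>0 'a::comm_monoid_add)"
  assumes "finite {m. f m \<noteq> 0}"
  shows "Poly_Mapping.lookup (Sum_any f) t = (\<Sum>m | f m \<noteq> 0. Poly_Mapping.lookup (f m) t)"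
  by (simp add: Sum_any.expand_set lookup_sum)

lemma lookup_Sum_any_weighted:
  fixes f :: "nat \<Rightarrow> ((nat \<Rightarrow>\<^sub>0 nat) \<Rightarrow>\<^sub>0 'a::comm_ring_1)"
  assumes "f \<in> external_direct_sum (weighted_component w)"
  shows "Poly_Mapping.lookup (Sum_any f) t = Poly_Mapping.lookup (f (weighted_degree w t)) t"
proof -
  have fin: "finite {m. f m \<noteq> 0}" and comp: "\<And>m. f m \<in> weighted_component w m"
    using assms by (auto simp: external_direct_sum_def)
  have zero: "Poly_Mapping.lookup (f m) t = 0" if "m \<noteq> weighted_degree w t" for m
    using comp[of m] that by (auto simp: weighted_component_def in_keys_iff)
  have "(\<Sum>m | f m \<noteq> 0. Poly_Mapping.lookup (f m) t)
      = (\<Sum>m | f m \<noteq> 0. if m = weighted_degree w t then Poly_Mapping.lookup (f m) t else 0)"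
    by (intro sum.cong) (auto simp: zero)
  also have "\<dots> = Poly_Mapping.lookup (f (weighted_degree w t)) t"
    using fin by (simp add: sum.delta)
  finally show ?thesis using lookup_Sum_any[OF fin] by simp
qed

lemma internal_direct_sum_weighted:
  "internal_direct_sum (polynomial_ring (length w) :: ((nat \<Rightarrow>\<^sub>0 nat) \<Rightarrow>\<^sub>0 'a::comm_ring_1) set)
     (weighted_component w)"
proof -
  let ?E = "external_direct_sum
    (weighted_component w :: nat \<Rightarrow> ((nat \<Rightarrow>\<^sub>0 nat) \<Rightarrow>\<^sub>0 'a) set)"
  have inj: "inj_on Sum_any ?E"
  proof (intro inj_onI ext poly_mapping_eqI)
    fix f g m t
    assume f: "f \<in> ?E" and g: "g \<in> ?E" and eq: "Sum_any f = Sum_any g"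
    show "Poly_Mapping.lookup (f m) t = Poly_Mapping.lookup (g m) t"
    proof (cases "m = weighted_degree w t")
      case True
      then show ?thesis
        using lookup_Sum_any_weighted[OF f, of t] lookup_Sum_any_weighted[OF g, of t] eq by simp
    next
      case False
      have "f m \<in> weighted_component w m" "g m \<in> weighted_component w m"
        using f g by (auto simp: external_direct_sum_def)
      with False have "t \<notin> Poly_Mapping.keys (f m)" "t \<notin> Poly_Mapping.keys (g m)"
        by (auto simp: weighted_component_def)
      then show ?thesis by (simp add: in_keys_iff)
    qed
  qed
  moreover have "Sum_any f \<in> polynomial_ring (length w)" if f: "f \<in> ?E" for f
  proof -
    have "f m \<in> weighted_component w m" for m
      using f by (auto simp: external_direct_sum_def)
    moreover have "t \<in> Poly_Mapping.keys (f (weighted_degree w t))"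
      if "t \<in> Poly_Mapping.keys (Sum_any f)" for t
      using that lookup_Sum_any_weighted[OF f, of t] by (simp add: in_keys_iff)
    ultimately show ?thesis
      unfolding weighted_component_def polynomial_ring_def by blast
  qed
  moreover have "p \<in> Sum_any ` ?E" if p: "p \<in> polynomial_ring (length w)"
    for p :: "(nat \<Rightarrow>\<^sub>0 nat) \<Rightarrow>\<^sub>0 'a"
  proof -
    define f where
      "f m = (\<Sum>t | t \<in> Poly_Mapping.keys p \<and> weighted_degree w t = m.
                Poly_Mapping.single t (Poly_Mapping.lookup p t))" for m
    have lf: "Poly_Mapping.lookup (f m) t = (if weighted_degree w t = m then Poly_Mapping.lookup p t else 0)" for m t
      unfolding f_def by (auto simp: lookup_sum lookup_single when_def sum.delta' in_keys_iff)
    have "f m \<in> weighted_component w m" for m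
      using p by (auto simp: weighted_component_def polynomial_ring_def in_keys_iff lf
          split: if_splits)
    moreover have "{m. f m \<noteq> 0} \<subseteq> weighted_degree w ` Poly_Mapping.keys p"
    proof
      fix m assume "m \<in> {m. f m \<noteq> 0}"
      then have "{t \<in> Poly_Mapping.keys p. weighted_degree w t = m} \<noteq> {}"
        unfolding f_def mem_Collect_eq using sum.empty by metis
      then show "m \<in> weighted_degree w ` Poly_Mapping.keys p" by auto
    qed
    then have "finite {m. f m \<noteq> 0}" by (rule finite_subset) simp
    ultimately have E: "f \<in> ?E" by (auto simp: external_direct_sum_def)
    have "Sum_any f = p"
      by (rule poly_mapping_eqI) (simp add: lookup_Sum_any_weighted[OF E] lf)
    with E show ?thesis by blast
  qed
  ultimately show ?thesis
    unfolding internal_direct_sum_def bij_betw_def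
    using additive_subgroup_weighted_component by blast
qed

lemma graded_ring_weighted:
  "graded_ring (polynomial_ring (length w) :: ((nat \<Rightarrow>\<^sub>0 nat) \<Rightarrow>\<^sub>0 'a::comm_ring_1) set)
     (weighted_component w)"
proof -
  have "p * q \<in> weighted_component w (i + j)"
    if p: "p \<in> weighted_component w i" and q: "q \<in> weighted_component w j"
    for i j and p q :: "(nat \<Rightarrow>\<^sub>0 nat) \<Rightarrow>\<^sub>0 'a"
  proof -
    have "Poly_Mapping.keys t \<subseteq> {..<length w} \<and> weighted_degree w t = i + j"
      if t: "t \<in> Poly_Mapping.keys (p * q)" for t
    proof -
      obtain a b where ab: "t = a + b" "a \<in> Poly_Mapping.keys p" "b \<in> Poly_Mapping.keys q"
        using t keys_mult[of p q] by blast
      then show ?thesis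
        using p q Poly_Mapping.keys_add[of a b]
        by (fastforce simp: weighted_component_def polynomial_ring_def weighted_degree_add)
    qed
    then show ?thesis by (auto simp: weighted_component_def polynomial_ring_def)
  qed
  moreover have "(1 :: (nat \<Rightarrow>\<^sub>0 nat) \<Rightarrow>\<^sub>0 'a) \<in> weighted_component w 0"
    by (auto simp: weighted_component_def polynomial_ring_def weighted_degree_def)
  ultimately show ?thesis
    unfolding graded_ring_def using internal_direct_sum_weighted by blast
qed

lemma veronese_subring_graded:
  fixes S :: "nat \<Rightarrow> 'b::ring_1 set"
  assumes "graded_ring R S" and r: "1 \<le> r"
  shows "graded_ring (veronese_subring r S) (veronese_component r S)"
    and "veronese_subring r S \<subseteq> R"
proof -
  let ?V = "external_direct_sum (veronese_component r S)" and ?E = "external_direct_sum S"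
  have sub: "\<And>m. additive_subgroup (S m)" and bij: "bij_betw Sum_any ?E R"
    and one: "1 \<in> S 0" and mult: "\<And>i j x y. x \<in> S i \<Longrightarrow> y \<in> S j \<Longrightarrow> x * y \<in> S (i + j)"
    using assms by (auto simp: graded_ring_def internal_direct_sum_def)
  define h :: "(nat \<Rightarrow> 'b) \<Rightarrow> nat \<Rightarrow> 'b" where
    "h f k = (if r dvd k then f (k div r) else 0)" for f k
  have hr: "h f (r * m) = f m" for f m
    using r by (simp add: h_def)
  have supp: "{k. h f k \<noteq> 0} = (\<lambda>m. r * m) ` {m. f m \<noteq> 0}" for f
    using r by (auto simp: h_def image_iff elim!: dvdE split: if_splits)
  have hE: "h f \<in> ?E" if f: "f \<in> ?V" for f
  proof -
    have "h f k \<in> S k" for k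
      using f r sub[of k]
      by (auto simp: h_def external_direct_sum_def veronese_component_def additive_subgroup_def
          elim!: dvdE)
    then show ?thesis
      using f by (simp add: external_direct_sum_def supp)
  qed
  have hS: "Sum_any (h f) = Sum_any f" for f
  proof -
    have "inj_on (\<lambda>m. r * m) {m. f m \<noteq> 0}" using r by (auto simp: inj_on_def)
    then show ?thesis
      by (simp add: Sum_any.expand_set supp sum.reindex hr)
  qed
  have "inj_on Sum_any ?V"
  proof (intro inj_onI ext)
    fix f g m assume fg: "f \<in> ?V" "g \<in> ?V" "Sum_any f = Sum_any g"
    then have "h f = h g"
      using bij_betw_imp_inj_on[OF bij] hE hS by (metis inj_onD)
    then show "f m = g m" using hr by metis
  qed
  then show "graded_ring (veronese_subring r S) (veronese_component r S)"
    using sub one mult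
    by (auto simp: graded_ring_def internal_direct_sum_def bij_betw_def veronese_subring_def
        veronese_component_def distrib_left)
  show "veronese_subring r S \<subseteq> R"
    using bij hE hS unfolding veronese_subring_def bij_betw_def by (metis image_subsetI imageI)
qed

lemma weight_vector_weak_step:
  assumes "weak_step v w" "weight_vector v"
  shows "weight_vector w"
  using assms
proof (cases rule: weak_step.cases)
  case permute
  then show ?thesis using assms(2) by (metis mset_eq_setD mset_zero_iff weight_vector_def)
next
  case (divide_others i c)
  then show ?thesis using assms(2)
    by (fastforce simp: weight_vector_def divide_others_def dvd_imp_le
        intro!: div_greater_zero_iff[THEN iffD2])
qed (use assms(2) in \<open>auto simp: weight_vector_def multiply_others_def dvd_imp_le
       div_greater_zero_iff Lcm_0_iff intro!: Nat.gr0I\<close>)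

end

theory Submission
  imports Defs
begin

text \<open>
  A monomial is regarded as the multiset of the weights of its factors. Generation in degree 1
  then means that every multiset of weights with sum a positive multiple of \<open>d\<close>, the least
  common multiple of the weights, has a submultiset with sum exactly \<open>d\<close>. This property depends
  only on the set of weights, and each of the operations (1)-(5) preserves it in both directions;
  for (5), the number of factors of weight \<open>w\<^sub>i\<close> is forced to be a multiple of the multiplier.
  So the weights may be assumed pairwise coprime and distinct, with product \<open>d\<close>.

  Let \<open>M\<close> be the largest weight. If there are \<open>M - 1\<close> factors of some weight \<open>q\<close>, split the
  remaining factors into blocks of length at most \<open>q\<close> with sum divisible by \<open>q\<close> (pigeonhole). A
  block weighs at most \<open>q * M\<close>, so some union of blocks lies at most \<open>q * (M - 1)\<close> below \<open>d\<close>, and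
  factors of weight \<open>q\<close> fill the gap. If there is no such \<open>q\<close> and fewer than \<open>d / M\<close> factors of
  weight \<open>M\<close>, the total is less than \<open>2 * d\<close>, hence equal to \<open>d\<close>.
\<close>

section \<open>Submultisets of sums and images of multisets\<close>

lemma subseteq_mset_plusE:
  assumes "B \<subseteq># X + Y"
  obtains X' Y' where "X' \<subseteq># X" "Y' \<subseteq># Y" "B = X' + Y'"
proof
  show "B \<inter># X \<subseteq># X" by simp
  show "B - X \<subseteq># Y" using assms by (simp add: subset_eq_diff_conv add.commute)
  show "B = B \<inter># X + (B - X)" by (rule multiset_eqI) (simp add: min_def)
qed

lemma subseteq_image_msetE:
  assumes "B \<subseteq># image_mset f A"
  obtains A' where "A' \<subseteq># A" "B = image_mset f A'"
proof -
  obtain C where "image_mset f A = B + C"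
    using assms by (auto simp: mset_subset_eq_exists_conv)
  from image_mset_eq_plusD[OF this] obtain A' C' where "A = A' + C'" "B = image_mset f A'"
    by blast
  then show ?thesis using that[of A'] by simp
qed

lemma set_mset_subset_imageE:
  assumes "set_mset A \<subseteq> f ` S"
  obtains B where "set_mset B \<subseteq> S" "A = image_mset f B"
proof
  have inv: "inv_into S f x \<in> S" "f (inv_into S f x) = x" if "x \<in># A" for x
    using assms that by (auto intro: inv_into_into f_inv_into_f)
  show "set_mset (image_mset (inv_into S f) A) \<subseteq> S" using inv(1) by auto
  have "image_mset (\<lambda>x. f (inv_into S f x)) A = image_mset (\<lambda>x. x) A"
    by (rule image_mset_cong) (rule inv(2))
  then show "A = image_mset f (image_mset (inv_into S f) A)"
    by (simp add: image_mset.compositionality comp_def)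
qed

lemma sum_mset_image_times:
  fixes c :: "'a::semiring_0"
  shows "\<Sum>\<^sub># (image_mset ((*) c) A) = c * \<Sum>\<^sub># A"
  using sum_mset_distrib_left[of c "\<lambda>x. x" A] by simp

lemma mset_partition_eq: "A = replicate_mset (count A a) a + {#x \<in># A. x \<noteq> a#}"
  using multiset_partition[of A "\<lambda>x. x = a"] by (simp add: filter_eq_replicate_mset)

section \<open>The splitting property under scaling and insertion of weights\<close>

text \<open>One part of sum \<open>Lcm S\<close> is enough to ask for: the remainder again has a
  multiple of \<open>Lcm S\<close> as its sum and can be split further.\<close>

definition splits_at_Lcm :: "nat set \<Rightarrow> bool" where
  "splits_at_Lcm S \<longleftrightarrow>
     (\<forall>A m. set_mset A \<subseteq> S \<longrightarrow> 0 < m \<longrightarrow> \<Sum>\<^sub># A = m * Lcm S \<longrightarrow>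
       (\<exists>B. B \<subseteq># A \<and> \<Sum>\<^sub># B = Lcm S))"

lemma splits_at_LcmI:
  assumes "\<And>A m. set_mset A \<subseteq> S \<Longrightarrow> 0 < m \<Longrightarrow> \<Sum>\<^sub># A = m * Lcm S \<Longrightarrow>
    \<exists>B. B \<subseteq># A \<and> \<Sum>\<^sub># B = Lcm S"
  shows "splits_at_Lcm S"
  using assms unfolding splits_at_Lcm_def by blast

lemma splits_at_LcmE:
  assumes "splits_at_Lcm S" "set_mset A \<subseteq> S" "0 < m" "\<Sum>\<^sub># A = m * Lcm S"
  obtains B where "B \<subseteq># A" "\<Sum>\<^sub># B = Lcm S"
  using assms unfolding splits_at_Lcm_def by blast

text \<open>Scaling by \<open>c\<close> matches the multisets over the two sets and multiplies all
  sums by \<open>c\<close>. The Lcm scales too, except that \<open>Lcm {} = 1\<close>; hence the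
  case distinction.\<close>

lemma splits_at_Lcm_times:
  assumes c: "0 < c"
  shows "splits_at_Lcm ((*) c ` S) \<longleftrightarrow> splits_at_Lcm S"
proof (cases "S = {}")
  case False
  then have L: "Lcm ((*) c ` S) = c * Lcm S" by (simp add: Lcm_mult)
  show ?thesis
  proof
    assume G: "splits_at_Lcm ((*) c ` S)"
    show "splits_at_Lcm S"
    proof (rule splits_at_LcmI)
      fix A m assume A: "set_mset A \<subseteq> S" "0 < m" "\<Sum>\<^sub># A = m * Lcm S"
      have 1: "set_mset (image_mset ((*) c) A) \<subseteq> (*) c ` S" using A by auto
      have 2: "\<Sum>\<^sub># (image_mset ((*) c) A) = m * Lcm ((*) c ` S)"
        using A by (simp add: sum_mset_image_times L)
      obtain B where B: "B \<subseteq># image_mset ((*) c) A" "\<Sum>\<^sub># B = c * Lcm S"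
        using splits_at_LcmE[OF G 1 A(2) 2] L by metis
      obtain A' where "A' \<subseteq># A" "B = image_mset ((*) c) A'"
        using subseteq_image_msetE[OF B(1)] .
      then show "\<exists>B. B \<subseteq># A \<and> \<Sum>\<^sub># B = Lcm S"
        using B(2) c by (auto simp: sum_mset_image_times)
    qed
  next
    assume G: "splits_at_Lcm S"
    show "splits_at_Lcm ((*) c ` S)"
    proof (rule splits_at_LcmI)
      fix A m assume A: "set_mset A \<subseteq> (*) c ` S" "0 < m" "\<Sum>\<^sub># A = m * Lcm ((*) c ` S)"
      obtain A0 where A0: "set_mset A0 \<subseteq> S" "A = image_mset ((*) c) A0"
        using set_mset_subset_imageE[OF A(1)] .
      have "\<Sum>\<^sub># A0 = m * Lcm S"
        using A(3) c by (simp add: A0(2) sum_mset_image_times L)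
      then obtain B where "B \<subseteq># A0" "\<Sum>\<^sub># B = Lcm S"
        using splits_at_LcmE[OF G A0(1) A(2)] by blast
      then show "\<exists>B. B \<subseteq># A \<and> \<Sum>\<^sub># B = Lcm ((*) c ` S)"
        by (auto simp: A0(2) L sum_mset_image_times intro!: exI[of _ "image_mset ((*) c) B"]
            image_mset_subseteq_mono)
    qed
  qed
qed simp

text \<open>A multiset containing the weight \<open>Lcm S\<close> has this single element as the
  required part; any other multiset lives on \<open>S\<close>.\<close>

lemma splits_at_Lcm_insert_Lcm:
  "splits_at_Lcm (insert (Lcm S) S) \<longleftrightarrow> splits_at_Lcm S"
proof
  assume G: "splits_at_Lcm (insert (Lcm S) S)"
  show "splits_at_Lcm S"
  proof (rule splits_at_LcmI)
    fix A m assume A: "set_mset A \<subseteq> S" "0 < m" "\<Sum>\<^sub># A = m * Lcm S"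
    show "\<exists>B. B \<subseteq># A \<and> \<Sum>\<^sub># B = Lcm S"
      using splits_at_LcmE[OF G _ A(2), of A] A by auto
  qed
next
  assume G: "splits_at_Lcm S"
  show "splits_at_Lcm (insert (Lcm S) S)"
  proof (rule splits_at_LcmI)
    fix A m
    assume A: "set_mset A \<subseteq> insert (Lcm S) S" "0 < m" "\<Sum>\<^sub># A = m * Lcm (insert (Lcm S) S)"
    show "\<exists>B. B \<subseteq># A \<and> \<Sum>\<^sub># B = Lcm (insert (Lcm S) S)"
    proof (cases "Lcm S \<in># A")
      case True
      then show ?thesis by (auto intro!: exI[of _ "{#Lcm S#}"])
    next
      case False
      then have "set_mset A \<subseteq> S" using A(1) by auto
      then show ?thesis using splits_at_LcmE[OF G _ A(2), of A] A(3) by auto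
    qed
  qed
qed

lemma lcm_mult_coprime_right:
  fixes a c L :: nat
  assumes "coprime c a"
  shows "lcm a (c * L) = c * lcm a L"
proof -
  have g: "gcd a (c * L) = gcd a L"
    using assms by (simp add: gcd_mult_right_left_cancel coprime_commute)
  show ?thesis by (simp add: lcm_nat_def g mult.left_commute div_mult_swap)
qed

text \<open>Since \<open>c\<close> copies of \<open>a\<close> weigh \<open>c * a\<close>, scaling
  the other weights and the multiplicity of \<open>a\<close> by \<open>c\<close> scales the sum by
  \<open>c\<close>, as it does the Lcm. Coprimality makes this reversible.\<close>

lemma splits_at_Lcm_times_others:
  assumes c: "0 < c" "coprime c a" and ne: "S \<noteq> {}"
  shows "splits_at_Lcm (insert a ((*) c ` S)) \<longleftrightarrow> splits_at_Lcm (insert a S)"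
proof
  have L: "Lcm (insert a ((*) c ` S)) = c * Lcm (insert a S)"
    using ne c by (simp add: Lcm_mult lcm_mult_coprime_right)
  {
    assume G: "splits_at_Lcm (insert a ((*) c ` S))"
    show "splits_at_Lcm (insert a S)"
    proof (rule splits_at_LcmI)
      fix A m assume A: "set_mset A \<subseteq> insert a S" "0 < m" "\<Sum>\<^sub># A = m * Lcm (insert a S)"
      define k A0 where "k = count A a" and "A0 = {#x \<in># A. x \<noteq> a#}"
      have Aeq: "A = replicate_mset k a + A0" unfolding k_def A0_def by (rule mset_partition_eq)
      have A0: "set_mset A0 \<subseteq> S" using A(1) by (auto simp: A0_def)
      let ?A = "replicate_mset (c * k) a + image_mset ((*) c) A0"
      have 1: "set_mset ?A \<subseteq> insert a ((*) c ` S)" using A0 by (auto split: if_splits)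
      have "\<Sum>\<^sub># ?A = c * \<Sum>\<^sub># A" by (simp add: Aeq sum_mset_image_times algebra_simps)
      then have 2: "\<Sum>\<^sub># ?A = m * Lcm (insert a ((*) c ` S))" unfolding L A(3) by simp
      obtain B where B: "B \<subseteq># ?A" "\<Sum>\<^sub># B = c * Lcm (insert a S)"
        using splits_at_LcmE[OF G 1 A(2) 2] L by metis
      obtain X Y where XY: "X \<subseteq># replicate_mset (c * k) a" "Y \<subseteq># image_mset ((*) c) A0" "B = X + Y"
        using subseteq_mset_plusE[OF B(1)] .
      obtain j where j: "j \<le> c * k" "X = replicate_mset j a"
        using XY(1) by (rule msubseteq_replicate_msetE)
      obtain Y0 where Y0: "Y0 \<subseteq># A0" "Y = image_mset ((*) c) Y0"
        using subseteq_image_msetE[OF XY(2)] .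
      have eq: "j * a + c * \<Sum>\<^sub># Y0 = c * Lcm (insert a S)"
        using B(2) by (simp add: XY(3) j(2) Y0(2) sum_mset_image_times)
      \<comment> \<open>All other terms are multiples of \<open>c\<close> and \<open>c\<close> is
        coprime to \<open>a\<close>, so the part holds a multiple of \<open>c\<close> copies of
        \<open>a\<close> and can be scaled back.\<close>
      then have "c dvd j * a"
        by (metis dvd_add_left_iff dvd_triv_left)
      then have "c dvd j" using c(2) by (simp add: coprime_dvd_mult_left_iff)
      then obtain j' where j': "j = c * j'" by blast
      let ?B = "replicate_mset j' a + Y0"
      have "j' \<le> k" using j(1) c(1) by (simp add: j')
      then have "?B \<subseteq># A"
        unfolding Aeq by (intro subset_mset.add_mono Y0) (simp add: replicate_mset_msubseteq_iff)
      moreover have "\<Sum>\<^sub># ?B = Lcm (insert a S)"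
      proof -
        have "c * \<Sum>\<^sub># ?B = c * Lcm (insert a S)" using eq by (simp add: j' algebra_simps)
        then show ?thesis using c(1) by simp
      qed
      ultimately show "\<exists>B. B \<subseteq># A \<and> \<Sum>\<^sub># B = Lcm (insert a S)" by blast
    qed
  next
    assume G: "splits_at_Lcm (insert a S)"
    show "splits_at_Lcm (insert a ((*) c ` S))"
    proof (rule splits_at_LcmI)
      fix A m
      assume A: "set_mset A \<subseteq> insert a ((*) c ` S)" "0 < m"
        "\<Sum>\<^sub># A = m * Lcm (insert a ((*) c ` S))"
      define k A1 where "k = count A a" and "A1 = {#x \<in># A. x \<noteq> a#}"
      have Aeq: "A = replicate_mset k a + A1" unfolding k_def A1_def by (rule mset_partition_eq)
      have "set_mset A1 \<subseteq> (*) c ` S" using A(1) by (auto simp: A1_def)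
      then obtain A0 where A0: "set_mset A0 \<subseteq> S" "A1 = image_mset ((*) c) A0"
        using set_mset_subset_imageE by blast
      have eq: "k * a + c * \<Sum>\<^sub># A0 = c * (m * Lcm (insert a S))"
        using A(3) unfolding L Aeq A0(2) by (simp add: sum_mset_image_times mult.left_commute)
      \<comment> \<open>Here the same argument applies to all copies of \<open>a\<close> in
        \<open>A\<close>, so that \<open>A\<close> can be scaled down before it is split.\<close>
      then have "c dvd k * a"
        by (metis dvd_add_left_iff dvd_triv_left)
      then have "c dvd k" using c(2) by (simp add: coprime_dvd_mult_left_iff)
      then obtain k' where k': "k = c * k'" by blast
      let ?A = "replicate_mset k' a + A0"
      have 1: "set_mset ?A \<subseteq> insert a S" using A0 by (auto split: if_splits)
      have 2: "\<Sum>\<^sub># ?A = m * Lcm (insert a S)"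
      proof -
        have "c * \<Sum>\<^sub># ?A = c * (m * Lcm (insert a S))" using eq by (simp add: k' algebra_simps)
        then show ?thesis using c(1) by simp
      qed
      obtain B where B: "B \<subseteq># ?A" "\<Sum>\<^sub># B = Lcm (insert a S)"
        using splits_at_LcmE[OF G 1 A(2) 2] .
      obtain X Y where XY: "X \<subseteq># replicate_mset k' a" "Y \<subseteq># A0" "B = X + Y"
        using subseteq_mset_plusE[OF B(1)] .
      obtain j where j: "j \<le> k'" "X = replicate_mset j a"
        using XY(1) by (rule msubseteq_replicate_msetE)
      let ?B = "replicate_mset (c * j) a + image_mset ((*) c) Y"
      have "?B \<subseteq># A"
        unfolding Aeq A0(2) k' using j(1)
        by (intro subset_mset.add_mono image_mset_subseteq_mono XY)
          (simp add: replicate_mset_msubseteq_iff)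
      moreover have "\<Sum>\<^sub># ?B = c * \<Sum>\<^sub># B"
        by (simp add: XY(3) j(2) sum_mset_image_times algebra_simps)
      ultimately show "\<exists>B. B \<subseteq># A \<and> \<Sum>\<^sub># B = Lcm (insert a ((*) c ` S))"
        using L B(2) by metis
    qed
  }
qed

section \<open>Invariance under weak equivalence\<close>

text \<open>Excluding the index \<open>i\<close> rather than the value \<open>w ! i\<close> matters:
  an equal entry at another position is still subject to \<open>f\<close>.\<close>

lemma set_map_nth_others:
  assumes "i < length w"
  shows "set (map (\<lambda>j. if j = i then w ! j else f (w ! j)) [0..<length w])
    = insert (w ! i) (f ` {w ! j | j. j < length w \<and> j \<noteq> i})"
proof -
  have I: "{0..<length w} = insert i {j. j < length w \<and> j \<noteq> i}" using assms by auto
  have "(\<lambda>j. if j = i then w ! j else f (w ! j)) ` {j. j < length w \<and> j \<noteq> i}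
      = (\<lambda>j. f (w ! j)) ` {j. j < length w \<and> j \<noteq> i}"
    by (rule image_cong) auto
  also have "\<dots> = f ` {w ! j | j. j < length w \<and> j \<noteq> i}" by blast
  finally show ?thesis by (simp only: set_map set_upt I image_insert) simp
qed

lemma set_conv_nth_others:
  assumes "i < length w"
  shows "set w = insert (w ! i) {w ! j | j. j < length w \<and> j \<noteq> i}"
  using assms by (auto simp: in_set_conv_nth)

lemma others_nonempty:
  assumes "2 \<le> length w"
  shows "{w ! j | j. j < length w \<and> j \<noteq> i} \<noteq> {}"
proof -
  have "(if i = 0 then 1 else 0) < length w \<and> (if i = 0 then 1 else 0) \<noteq> i" using assms by auto
  then show ?thesis by blast
qed

lemma splits_at_Lcm_weak_step:
  assumes "weak_step w v"
  shows "splits_at_Lcm (set w) \<longleftrightarrow> splits_at_Lcm (set v)"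
  using assms
proof cases
  case permute
  then show ?thesis by (metis mset_eq_setD)
next
  case (add_repeated x us vs)
  then have "set w = set v" by auto
  then show ?thesis by simp
next
  case (remove_repeated x us vs)
  then have "set w = set v" by auto
  then show ?thesis by simp
next
  case (multiply c)
  then show ?thesis using splits_at_Lcm_times by simp
next
  case (divide c)
  have "set w = (*) c ` set v"
    using divide by (force simp: image_image intro: rev_image_eqI)
  then show ?thesis using splits_at_Lcm_times divide(2) by simp
next
  case (add_lcm us vs x)
  have "set v = insert (Lcm (set w)) (set w)" using add_lcm by auto
  then show ?thesis using splits_at_Lcm_insert_Lcm by simp
next
  case (remove_lcm us vs x)
  have "set w = insert (Lcm (set v)) (set v)" using remove_lcm by auto
  then show ?thesis using splits_at_Lcm_insert_Lcm by simp
next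
  case (multiply_others i c)
  define S where "S = {w ! j | j. j < length w \<and> j \<noteq> i}"
  have "set v = insert (w ! i) ((*) c ` S)" "set w = insert (w ! i) S"
    unfolding S_def multiply_others(1) multiply_others_def
    using multiply_others(4) by (rule set_map_nth_others set_conv_nth_others)+
  then show ?thesis
    using splits_at_Lcm_times_others[OF multiply_others(5,6), of S]
      others_nonempty[OF multiply_others(2), of i] S_def by metis
next
  case (divide_others i c)
  define S where "S = {w ! j | j. j < length w \<and> j \<noteq> i}"
  define T where "T = (\<lambda>x. x div c) ` S"
  have v: "set v = insert (w ! i) T" and w: "set w = insert (w ! i) S"
    unfolding T_def S_def divide_others(1) divide_others_def
    using divide_others(4) by (rule set_map_nth_others set_conv_nth_others)+
  have dvd: "c dvd x" if "x \<in> S" for x using divide_others(6) that by (auto simp: S_def)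
  have S: "S = (*) c ` T" unfolding T_def using dvd by (force simp: image_image)
  \<comment> \<open>A common divisor of \<open>c\<close> and \<open>w ! i\<close> divides every
    entry, hence the gcd 1. So this division undoes a multiplication by a coprime factor.\<close>
  have "gcd c (w ! i) dvd Gcd (set w)"
    unfolding w using dvd by (auto intro!: Gcd_greatest intro: dvd_trans[OF gcd_dvd1])
  then have "coprime c (w ! i)" using divide_others(3) by (simp add: coprime_iff_gcd_eq_1)
  moreover have "T \<noteq> {}" using others_nonempty[OF divide_others(2), of i] unfolding T_def S_def by simp
  ultimately show ?thesis
    using splits_at_Lcm_times_others[OF divide_others(5)] v w S by simp
qed

lemma splits_at_Lcm_weakly_equivalent:
  assumes "weakly_equivalent w v"
  shows "splits_at_Lcm (set w) \<longleftrightarrow> splits_at_Lcm (set v)"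
proof -
  have "splits_at_Lcm (set x) \<longleftrightarrow> splits_at_Lcm (set y)" if "weak_step\<^sup>*\<^sup>* x y" for x y
    using that by induction (simp_all add: splits_at_Lcm_weak_step)
  then show ?thesis using assms unfolding weakly_equivalent_def by metis
qed

section \<open>Blocks with sum divisible by \<open>q\<close>\<close>

text \<open>Pigeonhole: two of the \<open>q + 1\<close> prefix sums of lengths 0 to \<open>q\<close>
  agree modulo \<open>q\<close>, and their difference is the sum of a segment.\<close>

lemma zero_sum_segment:
  fixes xs :: "nat list"
  assumes q: "0 < q" and len: "q \<le> length xs"
  obtains i j where "i < j" "j \<le> q" "q dvd sum_list (take (j - i) (drop i xs))"
proof -
  let ?f = "\<lambda>i. sum_list (take i xs) mod q"
  have "?f ` {..q} \<subseteq> {..<q}" using q by auto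
  then have "card (?f ` {..q}) \<le> q" using card_mono[of "{..<q}" "?f ` {..q}"] by simp
  then have "\<not> inj_on ?f {..q}" using card_image[of ?f "{..q}"] by auto
  then obtain a b where "a \<le> q" "b \<le> q" "a \<noteq> b" "?f a = ?f b" by (auto simp: inj_on_def)
  then obtain i j where ij: "i < j" "j \<le> q" "?f j = ?f i"
    using that by (cases a b rule: linorder_cases) auto
  have "take j xs = take i xs @ take (j - i) (drop i xs)"
    using ij(1) by (metis le_add_diff_inverse less_imp_le take_add)
  then have "sum_list (take j xs) = sum_list (take i xs) + sum_list (take (j - i) (drop i xs))"
    by simp
  then have "q dvd sum_list (take (j - i) (drop i xs))"
    using ij(3) by (metis add_diff_cancel_left' le_add1 mod_eq_dvd_iff_nat)
  with ij that show ?thesis by blast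
qed

lemma zero_sum_block:
  fixes A :: "nat multiset"
  assumes q: "0 < q" and A: "A \<noteq> {#}" "q dvd \<Sum>\<^sub># A"
  obtains B where "B \<subseteq># A" "B \<noteq> {#}" "size B \<le> q" "q dvd \<Sum>\<^sub># B"
proof (cases "q \<le> size A")
  case True
  obtain xs where xs: "A = mset xs" by (metis ex_mset)
  obtain i j where ij: "i < j" "j \<le> q" "q dvd sum_list (take (j - i) (drop i xs))"
    using zero_sum_segment[OF q, of xs] True xs by auto
  let ?B = "mset (take (j - i) (drop i xs))"
  have "mset xs = mset (take i xs) + (?B + mset (drop (j - i) (drop i xs)))"
    by (metis append_take_drop_id mset_append)
  then have "?B \<subseteq># A"
    unfolding xs by (metis mset_subset_eq_add_left mset_subset_eq_add_right subset_mset.order_trans)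
  \<comment> \<open>Nothing is truncated, because \<open>j \<le> q \<le> size A\<close>; so
    \<open>?B\<close> is nonempty and of size at most \<open>q\<close>.\<close>
  moreover have "size ?B = j - i" using ij True xs by simp
  ultimately show ?thesis using that[of ?B] ij by (auto simp: sum_mset_sum_list)
qed (use that[of A] A in auto)

lemma sum_mset_le_size_times:
  fixes A :: "nat multiset"
  assumes "\<And>x. x \<in># A \<Longrightarrow> x \<le> M"
  shows "\<Sum>\<^sub># A \<le> size A * M"
  using assms by (induction A) (simp_all add: add_mono)

text \<open>
  Blocks are removed from \<open>A\<close> one at a time. Each lowers the sum by at most \<open>q * M\<close>, so the sum
  cannot jump over the window below \<open>T\<close>.
\<close>
lemma sum_mset_in_window:
  fixes A :: "nat multiset"
  assumes q: "0 < q" "q dvd \<Sum>\<^sub># A" "q dvd T" and M: "\<And>x. x \<in># A \<Longrightarrow> x \<le> M" "M \<le> r + 1"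
    and T: "T \<le> \<Sum>\<^sub># A + q * r"
  obtains B where "B \<subseteq># A" "\<Sum>\<^sub># B \<le> T" "T \<le> \<Sum>\<^sub># B + q * r" "q dvd \<Sum>\<^sub># B"
proof -
  have "\<exists>B. B \<subseteq># A \<and> \<Sum>\<^sub># B \<le> T \<and> T \<le> \<Sum>\<^sub># B + q * r \<and> q dvd \<Sum>\<^sub># B"
    using q(2) M(1) T
  proof (induction "size A" arbitrary: A rule: less_induct)
    case less
    show ?case
    proof (cases "\<Sum>\<^sub># A \<le> T")
      case False
      then have "A \<noteq> {#}" by auto
      then obtain C where C: "C \<subseteq># A" "C \<noteq> {#}" "size C \<le> q" "q dvd \<Sum>\<^sub># C"
        using zero_sum_block[OF q(1) _ less.prems(1)] by blast
      have sum: "\<Sum>\<^sub># A = \<Sum>\<^sub># (A - C) + \<Sum>\<^sub># C"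
        using C(1) by (metis subset_mset.diff_add sum_mset.union)
      have "\<Sum>\<^sub># C \<le> size C * M"
        using less.prems(2) C(1) by (intro sum_mset_le_size_times) (meson mset_subset_eqD)
      also have "\<dots> \<le> q * (r + 1)" using C(3) M(2) by (rule mult_le_mono)
      finally have C_le: "\<Sum>\<^sub># C \<le> q * r + q" by simp
      \<comment> \<open>Both \<open>\<Sum>\<^sub># A\<close> and \<open>T\<close> are multiples of
        \<open>q\<close>, so \<open>A\<close> exceeds \<open>T\<close> by at least \<open>q\<close>.
        This covers the difference between the block bound \<open>q * r + q\<close> and the window
        width \<open>q * r\<close>.\<close>
      obtain a b where "\<Sum>\<^sub># A = q * a" "T = q * b" using less.prems(1) q(3) by (meson dvdE)
      moreover from this False q(1) have "b + 1 \<le> a" by simp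
      then have "q * (b + 1) \<le> q * a" by (rule mult_le_mono2)
      ultimately have "T + q \<le> \<Sum>\<^sub># A" by simp
      then have T: "T \<le> \<Sum>\<^sub># (A - C) + q * r" using sum C_le by linarith
      have "size (A - C) < size A"
        using C(1,2)
        by (simp add: size_Diff_submset nonempty_has_size size_mset_mono less_le_trans)
      moreover have "q dvd \<Sum>\<^sub># (A - C)"
        using less.prems(1) C(4) sum by (metis dvd_add_left_iff)
      moreover have "x \<le> M" if "x \<in># A - C" for x using less.prems(2) that by (meson in_diffD)
      ultimately obtain B where "B \<subseteq># A - C" "\<Sum>\<^sub># B \<le> T" "T \<le> \<Sum>\<^sub># B + q * r" "q dvd \<Sum>\<^sub># B"
        using less.hyps[of "A - C"] T by blast
      then show ?thesis by (meson diff_subset_eq_self subset_mset.order_trans)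
    qed (use less.prems in auto)
  qed
  then show ?thesis using that by blast
qed

section \<open>Splitting for pairwise coprime weights\<close>

text \<open>Induction by \<open>x + s \<le> x * s\<close> for \<open>x\<close> and \<open>s\<close>
  at least 2; for \<open>s = \<Sum>S\<close> this needs \<open>S\<close> nonempty.\<close>

lemma sum_le_prod_nat:
  fixes S :: "nat set"
  assumes "finite S" "\<And>x. x \<in> S \<Longrightarrow> 2 \<le> x"
  shows "\<Sum>S \<le> \<Prod>S"
  using assms
proof (induction S)
  case (insert x S)
  show ?case
  proof (cases "S = {}")
    case False
    then obtain y where "y \<in> S" by blast
    then have "2 \<le> \<Sum>S" using insert member_le_sum[of y S "\<lambda>x. x"] by fastforce
    moreover have "\<Sum>S \<le> \<Prod>S" "2 \<le> x" using insert by auto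
    ultimately have "x + \<Sum>S \<le> x * \<Sum>S"
      by (metis add_mono mult_2 mult_2_right nat_le_linear mult_le_mono1 mult_le_mono2 order_trans)
    also have "\<dots> \<le> x * \<Prod>S" using \<open>\<Sum>S \<le> \<Prod>S\<close> by simp
    finally show ?thesis using insert by simp
  qed simp
qed simp

text \<open>The weight 1 adds 1 to the sum and leaves the product alone; all other weights are at
  least 2.\<close>

lemma sum_le_Suc_prod_nat:
  fixes S :: "nat set"
  assumes "finite S" "\<And>x. x \<in> S \<Longrightarrow> 0 < x"
  shows "\<Sum>S \<le> \<Prod>S + 1"
proof -
  have "\<Sum>(S - {1}) \<le> \<Prod>(S - {1})"
    using assms by (intro sum_le_prod_nat) (auto simp: nat_neq_iff Suc_le_eq numeral_2_eq_2)
  moreover have "\<Prod>(S - {1}) = \<Prod>S" by (rule prod.mono_neutral_left) (use assms in auto)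
  moreover have "\<Sum>S \<le> 1 + \<Sum>(S - {1})"
    using assms(1) by (cases "1 \<in> S") (auto simp: sum.remove[of S 1])
  ultimately show ?thesis by linarith
qed

lemma sum_mset_image_eq_sum_count:
  fixes f :: "'b \<Rightarrow> nat"
  assumes "finite S" "set_mset A \<subseteq> S"
  shows "\<Sum>\<^sub># (image_mset f A) = (\<Sum>x\<in>S. f x * count A x)"
  using assms(2)
proof (induction A)
  case (add a A)
  have "(\<Sum>x\<in>S. f x * count (add_mset a A) x) = (\<Sum>x\<in>S. f x * count A x + (if x = a then f a else 0))"
    by (rule sum.cong) auto
  then show ?case using add assms(1) by (simp add: sum.distrib)
qed simp

text \<open>The copies of \<open>q\<close> are set aside as filler. Some part of the rest falls
  short of \<open>d\<close> by a multiple of \<open>q\<close> within their total weight, so they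
  close the gap exactly.\<close>

lemma submset_sum_of_many_copies:
  fixes A :: "nat multiset"
  assumes q: "0 < q" "q dvd d" and sum: "q dvd \<Sum>\<^sub># A" "d \<le> \<Sum>\<^sub># A"
    and M: "\<And>x. x \<in># A \<Longrightarrow> x \<le> M" "M \<le> count A q + 1"
  obtains B where "B \<subseteq># A" "\<Sum>\<^sub># B = d"
proof -
  define r A0 where "r = count A q" and "A0 = {#x \<in># A. x \<noteq> q#}"
  have Aeq: "A = replicate_mset r q + A0" unfolding r_def A0_def by (rule mset_partition_eq)
  have s: "\<Sum>\<^sub># A = q * r + \<Sum>\<^sub># A0" unfolding Aeq by (simp add: mult.commute)
  have "q dvd \<Sum>\<^sub># A0" using sum(1) unfolding s by (simp add: dvd_add_right_iff)
  moreover have "\<And>x. x \<in># A0 \<Longrightarrow> x \<le> M" using M(1) by (simp add: A0_def)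
  moreover have "M \<le> r + 1" using M(2) by (simp add: r_def)
  ultimately obtain B where B: "B \<subseteq># A0" "\<Sum>\<^sub># B \<le> d" "d \<le> \<Sum>\<^sub># B + q * r" "q dvd \<Sum>\<^sub># B"
    using sum_mset_in_window[of q A0 d M r] q sum(2) s by (metis add.commute)
  obtain k where k: "d - \<Sum>\<^sub># B = q * k" using q(2) B(4) by (meson dvd_diff_nat dvdE)
  have "q * k \<le> q * r" using B(3) k by linarith
  then have "k \<le> r" using q(1) by simp
  then have "replicate_mset k q + B \<subseteq># A"
    unfolding Aeq by (intro subset_mset.add_mono B) (simp add: replicate_mset_msubseteq_iff)
  moreover have "\<Sum>\<^sub># (replicate_mset k q + B) = d" using k B(2) by (simp add: mult.commute)
  ultimately show ?thesis using that by blast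
qed

lemma submset_sum_prod:
  fixes S :: "nat set"
  assumes S: "finite S" "\<And>x. x \<in> S \<Longrightarrow> 0 < x"
    and A: "set_mset A \<subseteq> S" "0 < m" "\<Sum>\<^sub># A = m * \<Prod>S"
  obtains B where "B \<subseteq># A" "\<Sum>\<^sub># B = \<Prod>S"
proof -
  define d where "d = \<Prod>S"
  have d0: "0 < d" unfolding d_def using S(2) by (simp add: prod_pos)
  have dvd: "q dvd d" if "q \<in> S" for q unfolding d_def using S(1) that by (rule dvd_prodI)
  have le: "d \<le> \<Sum>\<^sub># A" and dvd_sum: "q dvd \<Sum>\<^sub># A" if "q \<in> S" for q
    using A(2,3) dvd that by (auto simp: d_def)
  have "S \<noteq> {}" using A d0 by (auto simp: d_def)
  define M where "M = Max S"
  have M: "M \<in> S" "\<And>x. x \<in> S \<Longrightarrow> x \<le> M" using S(1) \<open>S \<noteq> {}\<close> by (auto simp: M_def)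
  define P where "P = \<Prod>(S - {M})"
  have dM: "d = M * P" unfolding d_def P_def using S(1) M(1) by (rule prod.remove)
  \<comment> \<open>The part is all of \<open>A\<close>, or \<open>P\<close> copies of
    \<open>M\<close>, or it uses enough copies of some \<open>q\<close> as filler. The remaining
    case, where all counts are small and \<open>m \<ge> 2\<close>, is contradictory.\<close>
  consider "m = 1" | "P \<le> count A M" | q where "q \<in> S" "M \<le> count A q + 1"
    | "2 \<le> m" "count A M < P" "\<And>q. q \<in> S \<Longrightarrow> count A q + 2 \<le> M"
    using A(2) by force
  then have "\<exists>B. B \<subseteq># A \<and> \<Sum>\<^sub># B = d"
  proof cases
    case 1
    then show ?thesis using A(3) d_def by auto
  next
    case 2
    then show ?thesis by (intro exI[of _ "replicate_mset P M"]) (simp add: dM count_le_replicate_mset_subset_eq)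
  next
    case 3
    then show ?thesis
      using submset_sum_of_many_copies[of q d A M] S(2) dvd dvd_sum le A(1) M(2) by (metis subsetD)
  next
    case 4
    let ?R = "S - {M}"
    \<comment> \<open>Counts are at most \<open>M - 2\<close>. Keeping the 2 on the left makes the
      final bound on the total strict unless \<open>\<Sum>?R = 0\<close>.\<close>
    have "(\<Sum>x\<in>?R. x * (count A x + 2)) \<le> (\<Sum>x\<in>?R. x * M)"
      using 4(3) by (intro sum_mono mult_le_mono2) auto
    also have "\<dots> = \<Sum>?R * M" by (simp add: sum_distrib_right)
    also have "\<dots> \<le> (P + 1) * M"
      unfolding P_def using S by (intro mult_le_mono1 sum_le_Suc_prod_nat) auto
    finally have R: "(\<Sum>x\<in>?R. x * count A x) + 2 * \<Sum>?R \<le> d + M"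
      by (simp add: dM distrib_left sum.distrib mult.commute flip: sum_distrib_left)
    \<comment> \<open>The \<open>M\<close> saved here cancels the extra \<open>M\<close> caused by
      the bound \<open>P + 1\<close> on \<open>\<Sum>?R\<close>.\<close>
    have "M * (count A M + 1) \<le> M * P" using 4(2) by (intro mult_le_mono2) simp
    then have MM: "M * count A M + M \<le> d" by (simp add: dM)
    have total: "\<Sum>\<^sub># A = M * count A M + (\<Sum>x\<in>?R. x * count A x)"
      using sum_mset_image_eq_sum_count[OF S(1) A(1), of "\<lambda>x. x"] S(1) M(1) by (simp add: sum.remove)
    have "2 * d \<le> \<Sum>\<^sub># A" using 4(1) A(3) by (simp add: d_def)
    \<comment> \<open>The two bounds add up to
      \<open>\<Sum>\<^sub># A + 2 * \<Sum>?R \<le> 2 * d\<close>. So only \<open>M\<close>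
      contributes, and its copies alone weigh at most \<open>d\<close>.\<close>
    then have "\<Sum>?R = 0" using total R MM by linarith
    then have "\<forall>x\<in>?R. x = 0" using S(1) by simp
    then have "(\<Sum>x\<in>?R. x * count A x) = 0" by (intro sum.neutral ballI) simp
    then have "\<Sum>\<^sub># A = M * count A M" using total by linarith
    then have False using MM \<open>2 * d \<le> \<Sum>\<^sub># A\<close> d0 by linarith
    then show ?thesis ..
  qed
  then show ?thesis using that d_def by blast
qed

text \<open>Passing to \<open>set v\<close> discards repetitions, and the Lcm of distinct pairwise
  coprime weights is their product.\<close>

lemma splits_at_Lcm_pairwise_coprime:
  assumes "weight_vector v" "pairwise_coprime v"
  shows "splits_at_Lcm (set v)"
proof -
  have "coprime x y" if "x \<in> set v" "y \<in> set v" "x \<noteq> y" for x y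
    using assms(2) that unfolding pairwise_coprime_def by (metis in_set_conv_nth)
  then have L: "Lcm (set v) = \<Prod>(set v)"
    using assms(1) by (subst Lcm_coprime) (auto simp: weight_vector_def)
  show ?thesis
    using submset_sum_prod[of "set v"] assms(1) unfolding splits_at_Lcm_def L weight_vector_def
    by (metis List.finite_set)
qed

section \<open>From multisets of weights to the Veronese subring\<close>

text \<open>The exponent vector becomes a multiset of indices, not of weights, because several
  indeterminates may share a weight. The part found among the weights is lifted back to
  indices.\<close>

lemma exponent_split:
  assumes G: "splits_at_Lcm (set w)"
    and t: "Poly_Mapping.keys t \<subseteq> {..<length w}" "weighted_degree w t = m * Lcm (set w)" "0 < m"
  obtains s u where "t = s + u" "weighted_degree w s = Lcm (set w)"
proof -
  have deg: "weighted_degree w s = \<Sum>\<^sub># (image_mset ((!) w) A)"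
    if "count A = Poly_Mapping.lookup s" "set_mset A \<subseteq> {..<length w}" for s A
    using sum_mset_image_eq_sum_count[OF _ that(2), of "(!) w"] by (simp add: weighted_degree_def that(1))
  define A where "A = Abs_multiset (Poly_Mapping.lookup t)"
  have cA: "count A = Poly_Mapping.lookup t"
    unfolding A_def by (rule count_Abs_multiset) (simp add: finite_lookup)
  have sA: "set_mset A = Poly_Mapping.keys t" by (simp add: set_mset_def cA keys.rep_eq)
  have "set_mset (image_mset ((!) w) A) \<subseteq> set w" using t(1) by (auto simp: sA)
  moreover have "\<Sum>\<^sub># (image_mset ((!) w) A) = m * Lcm (set w)"
    using deg[OF cA] t sA by simp
  ultimately obtain B where B: "B \<subseteq># image_mset ((!) w) A" "\<Sum>\<^sub># B = Lcm (set w)"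
    using splits_at_LcmE[OF G _ t(3)] by blast
  obtain A' where A': "A' \<subseteq># A" "B = image_mset ((!) w) A'" using subseteq_image_msetE[OF B(1)] .
  define s where "s = Abs_poly_mapping (count A')"
  have ls: "Poly_Mapping.lookup s = count A'"
    unfolding s_def by (rule lookup_Abs_poly_mapping) simp
  \<comment> \<open>Subtraction of exponents is truncated; it is exact here because
    \<open>A'\<close> is contained in \<open>A\<close>.\<close>
  have "t = s + (t - s)"
    using A'(1) by (intro poly_mapping_eqI)
      (simp add: lookup_add lookup_minus ls mset_subset_eq_count flip: cA)
  moreover have "weighted_degree w s = Lcm (set w)"
    using deg[OF ls[symmetric]] B(2) A' set_mset_mono[OF A'(1)] t(1) sA by simp
  ultimately show ?thesis using that by blast
qed

text \<open>Each step splits off a monomial with coefficient 1, and \<open>c\<close> stays with the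
  last factor. At least one factor is therefore present to carry it, since an additive power allows
  no scalars outside its products.\<close>

lemma single_eq_prod_list:
  fixes c :: "'a::comm_ring_1"
  assumes "splits_at_Lcm (set w)"
    and "Poly_Mapping.keys t \<subseteq> {..<length w}" "weighted_degree w t = Suc k * Lcm (set w)"
  shows "\<exists>xs. Poly_Mapping.single t c = prod_list xs \<and> length xs = Suc k \<and>
    set xs \<subseteq> weighted_component w (Lcm (set w))"
  using assms(2,3)
proof (induction k arbitrary: t)
  case 0
  then show ?case
    by (intro exI[of _ "[Poly_Mapping.single t c]"])
      (auto simp: weighted_component_def polynomial_ring_def)
next
  case (Suc k)
  obtain s u where su: "t = s + u" "weighted_degree w s = Lcm (set w)"
    using exponent_split[OF assms(1) Suc.prems] by blast
  have keys: "Poly_Mapping.keys t = Poly_Mapping.keys s \<union> Poly_Mapping.keys u"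
    by (auto simp: su(1) in_keys_iff lookup_add)
  have "weighted_degree w u = Suc k * Lcm (set w)"
    using Suc.prems(2) su by (simp add: weighted_degree_add)
  then obtain xs where xs: "Poly_Mapping.single u c = prod_list xs" "length xs = Suc k"
      "set xs \<subseteq> weighted_component w (Lcm (set w))"
    using Suc.IH[of u] Suc.prems(1) keys by auto
  have "Poly_Mapping.single t c = prod_list (Poly_Mapping.single s 1 # xs)"
    by (simp add: su(1) mult_single flip: xs(1))
  moreover have "Poly_Mapping.single s (1::'a) \<in> weighted_component w (Lcm (set w))"
    using Suc.prems(1) keys su(2) by (auto simp: weighted_component_def polynomial_ring_def)
  ultimately show ?case using xs by (intro exI[of _ "Poly_Mapping.single s 1 # xs"]) simp
qed

lemma additive_subgroup_hull: "additive_subgroup (additive_subgroup hull X)"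
  by (rule hull_in) (auto simp: additive_subgroup_def)

lemma sum_single_lookup:
  "(\<Sum>t\<in>Poly_Mapping.keys p. Poly_Mapping.single t (Poly_Mapping.lookup p t)) = p"
  by (rule poly_mapping_eqI)
    (auto simp: lookup_sum lookup_single when_def sum.delta' in_keys_iff)

lemma additive_power_veronese_component:
  fixes w :: "nat list"
  defines "V \<equiv> veronese_component (Lcm (set w))
    (weighted_component w :: nat \<Rightarrow> ((nat \<Rightarrow>\<^sub>0 nat) \<Rightarrow>\<^sub>0 'a::comm_ring_1) set)"
  assumes G: "splits_at_Lcm (set w)" and pos: "0 < Lcm (set w)"
  shows "additive_power (V 1) (Suc k) = V (Suc k)"
proof
  have graded: "graded_ring (veronese_subring (Lcm (set w)) (weighted_component w)) V"
    unfolding V_def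
    by (rule veronese_subring_graded(1)[OF graded_ring_weighted]) (use pos in linarith)
  then have mult: "x * y \<in> V (i + j)" if "x \<in> V i" "y \<in> V j" for i j x y
    using that by (simp add: graded_ring_def)
  have "prod_list xs \<in> V (length xs)" if "set xs \<subseteq> V 1" for xs
    using that
  proof (induction xs)
    case Nil
    then show ?case using graded by (simp add: graded_ring_def)
  next
    case (Cons x xs)
    then have "x \<in> V 1" "prod_list xs \<in> V (length xs)" by simp_all
    then have "x * prod_list xs \<in> V (1 + length xs)"
      using mult by blast
    then show ?case by simp
  qed
  then show "additive_power (V 1) (Suc k) \<subseteq> V (Suc k)"
    unfolding additive_power_def
  proof (intro hull_minimal)
    show "additive_subgroup (V (Suc k))"
      using graded by (simp add: graded_ring_def internal_direct_sum_def)
  qed fastforce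
  show "V (Suc k) \<subseteq> additive_power (V 1) (Suc k)"
  proof
    fix p assume "p \<in> V (Suc k)"
    then have t: "Poly_Mapping.keys t \<subseteq> {..<length w}" "weighted_degree w t = Suc k * Lcm (set w)"
      if "t \<in> Poly_Mapping.keys p" for t
      using that by (auto simp: V_def veronese_component_def weighted_component_def
          polynomial_ring_def)
    \<comment> \<open>Each term of \<open>p\<close> is a single product with its coefficient
      absorbed, so closure under addition suffices.\<close>
    have "(\<Sum>t\<in>Poly_Mapping.keys p. Poly_Mapping.single t (Poly_Mapping.lookup p t))
        \<in> additive_power (V 1) (Suc k)"
      unfolding additive_power_def
    proof (intro additive_subgroup_sum additive_subgroup_hull hull_inc)
      fix t assume "t \<in> Poly_Mapping.keys p"
      then show "Poly_Mapping.single t (Poly_Mapping.lookup p t)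
          \<in> {prod_list xs |xs. length xs = Suc k \<and> set xs \<subseteq> V 1}"
        using single_eq_prod_list[OF G t] by (auto simp: V_def veronese_component_def)
    qed
    then show "p \<in> additive_power (V 1) (Suc k)" by (simp only: sum_single_lookup)
  qed
qed

theorem theorem1p11:
  fixes n :: nat and w v :: "nat list"
  assumes "1 \<le> n" and "length w = n" and "\<forall>x\<in>set w. 0 < x"
    and "weight_vector v" and "pairwise_coprime v" and "weakly_equivalent w v"
  shows "generated_in_degree_1
    (veronese_subring (Lcm (set w))
       (weighted_component w :: nat \<Rightarrow> ((nat \<Rightarrow>\<^sub>0 nat) \<Rightarrow>\<^sub>0 'a::comm_ring_1) set))
    (veronese_component (Lcm (set w)) (weighted_component w))"
proof -
  let ?V = "veronese_component (Lcm (set w))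
    (weighted_component w :: nat \<Rightarrow> ((nat \<Rightarrow>\<^sub>0 nat) \<Rightarrow>\<^sub>0 'a) set)"
  have G: "splits_at_Lcm (set w)"
    using splits_at_Lcm_pairwise_coprime[OF assms(4,5)] splits_at_Lcm_weakly_equivalent[OF assms(6)]
    by simp
  have pos: "0 < Lcm (set w)" using assms(3) by (auto simp: Lcm_0_iff intro!: Nat.gr0I)
  \<comment> \<open>Degree 0 agrees outright, positive degrees by the equality of powers and
    components. What remains is the direct sum decomposition of the Veronese subring.\<close>
  have "(\<lambda>m. if m = 0 then ?V 0 else additive_power (?V 1) m) = ?V"
    using additive_power_veronese_component[OF G pos] by (intro ext) (auto simp: gr0_conv_Suc)
  moreover have "graded_ring (veronese_subring (Lcm (set w)) (weighted_component w)) ?V"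
    by (rule veronese_subring_graded(1)[OF graded_ring_weighted]) (use pos in linarith)
  ultimately show ?thesis by (simp add: generated_in_degree_1_def graded_ring_def)
qed

end
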